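(* Let $(A,+,\vee,\wedge,\ast,0)$ be an AL-monoid with unity $1$. Then the complemented elements of $A$, with the lattice operations of $A$ and with bounds $0$ and $1$, form a Boolean algebra.
   Context: A commutative lattice ordered monoid $(A,+,\vee,\wedge,0)$ is a commutative monoid $(A,+)$ with identity element $0$ together with a lattice structure $(A,\vee,\wedge)$ such that $a+(b\vee c)=(a+b)\vee(a+c)$ and $a+(b\wedge c)=(a+b)\wedge(a+c)$ for all $a,b,c\in A$; $\leq$ denotes the lattice order. The element $0$ is not assumed to be the least element of $A$. An autometrized lattice ordered monoid (AL-monoid) is an algebra $(A,+,\vee,\wedge,\ast,0)$ of arity $(2,2,2,2,0)$ such that: (1) $(A,+,\vee,\wedge,0)$ is a commutative lattice ordered monoid; (2) $a\ast(a\wedge b)+b=a\vee b$ for all $a,b\in A$ (here $a\ast(a\wedge b)+b$ means $(a\ast(a\wedge b))+b$); (3) for each $a\in A$, the mappings $x\mapsto a+x$, $x\mapsto a\vee x$, $x\mapsto a\wedge x$ and $x\mapsto a\ast x$ are contractions with respect to $\ast$, where $f:A\to A$ is a contraction if $f(x)\ast f(y)\leq x\ast y$ for all $x,y\in A$; (4) $[a\ast(a\vee b)]\wedge[b\ast(a\vee b)]=0$ for all $a,b\in A$. $A$ has unity $1$ if $1\in A$ is an element such that $a+(a\ast 1)=1$ for all $a\in A$. An element $a\in A$ is complemented if there is $a'\in A$ (a complement of $a$) with $a\wedge a'=0$ and $a\vee a'=1$. *)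

theory Defs
  imports Main
begin

class comm_lattice_ordered_monoid = comm_monoid_add + lattice +
  assumes add_sup_distrib: "a + sup b c = sup (a + b) (a + c)"
    and add_inf_distrib: "a + inf b c = inf (a + b) (a + c)"

text \<open>The distance takes its values in the algebra itself.\<close>

definition (in ord) contraction :: "('a \<Rightarrow> 'a \<Rightarrow> 'a) \<Rightarrow> ('a \<Rightarrow> 'a) \<Rightarrow> bool"
  where "contraction d f \<longleftrightarrow> (\<forall>x y. d (f x) (f y) \<le> d x y)"

text \<open>
  The operation \<open>ast\<close> is not assumed to be symmetric or to satisfy any metric axiom
  beyond those listed.
\<close>

class al_monoid = comm_lattice_ordered_monoid +
  fixes ast :: "'a \<Rightarrow> 'a \<Rightarrow> 'a"
  assumes ast_inf_add: "ast a (inf a b) + b = sup a b"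
    and contraction_add: "contraction ast (\<lambda>x. a + x)"
    and contraction_sup: "contraction ast (\<lambda>x. sup a x)"
    and contraction_inf: "contraction ast (\<lambda>x. inf a x)"
    and contraction_ast: "contraction ast (\<lambda>x. ast a x)"
    and inf_ast_sup: "inf (ast a (sup a b)) (ast b (sup a b)) = 0"

definition is_unity :: "'a::al_monoid \<Rightarrow> bool"
  where "is_unity u \<longleftrightarrow> (\<forall>a. a + ast a u = u)"

text \<open>Here \<open>u\<close> plays the role of the unity; the lower bound is the monoid identity.\<close>

definition complemented :: "'a::al_monoid \<Rightarrow> 'a \<Rightarrow> bool"
  where "complemented u a \<longleftrightarrow> (\<exists>a'. inf a a' = 0 \<and> sup a a' = u)"

text \<open>
  A Boolean algebra on a carrier set: a complemented distributive lattice with bounds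
  \<open>z\<close> and \<open>u\<close>. Complements are required to lie in the carrier.
  The class of Boolean algebras in Main always lives on a whole type.
\<close>

locale boolean_algebra_on =
  fixes B :: "'a set"
    and meet :: "'a \<Rightarrow> 'a \<Rightarrow> 'a"
    and join :: "'a \<Rightarrow> 'a \<Rightarrow> 'a"
    and z :: 'a
    and u :: 'a
  assumes meet_closed: "\<lbrakk>x \<in> B; y \<in> B\<rbrakk> \<Longrightarrow> meet x y \<in> B"
    and join_closed: "\<lbrakk>x \<in> B; y \<in> B\<rbrakk> \<Longrightarrow> join x y \<in> B"
    and zero_closed: "z \<in> B"
    and unit_closed: "u \<in> B"
    and meet_commute: "\<lbrakk>x \<in> B; y \<in> B\<rbrakk> \<Longrightarrow> meet x y = meet y x"
    and join_commute: "\<lbrakk>x \<in> B; y \<in> B\<rbrakk> \<Longrightarrow> join x y = join y x"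
    and meet_assoc: "\<lbrakk>x \<in> B; y \<in> B; w \<in> B\<rbrakk> \<Longrightarrow> meet (meet x y) w = meet x (meet y w)"
    and join_assoc: "\<lbrakk>x \<in> B; y \<in> B; w \<in> B\<rbrakk> \<Longrightarrow> join (join x y) w = join x (join y w)"
    and meet_join_absorb: "\<lbrakk>x \<in> B; y \<in> B\<rbrakk> \<Longrightarrow> meet x (join x y) = x"
    and join_meet_absorb: "\<lbrakk>x \<in> B; y \<in> B\<rbrakk> \<Longrightarrow> join x (meet x y) = x"
    and meet_join_distrib:
      "\<lbrakk>x \<in> B; y \<in> B; w \<in> B\<rbrakk> \<Longrightarrow> meet x (join y w) = join (meet x y) (meet x w)"
    and join_meet_distrib:
      "\<lbrakk>x \<in> B; y \<in> B; w \<in> B\<rbrakk> \<Longrightarrow> join x (meet y w) = meet (join x y) (join x w)"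
    and join_zero: "x \<in> B \<Longrightarrow> join x z = x"
    and meet_unit: "x \<in> B \<Longrightarrow> meet x u = x"
    and complement_exists: "x \<in> B \<Longrightarrow> \<exists>y\<in>B. meet x y = z \<and> join x y = u"

end

theory Submission
  imports Defs
begin

text \<open>
  Contracting by \<open>x \<sqinter> y\<close> shows \<open>x * y \<ge> 0\<close>, so the unity is the greatest element.  The lattice
  is distributive: with \<open>s = x \<sqinter> (y \<squnion> z)\<close> and \<open>w = (x \<sqinter> y) \<squnion> (x \<sqinter> z)\<close>, contractivity bounds
  \<open>s * w\<close> by both \<open>(y \<squnion> z) * y\<close> and \<open>(y \<squnion> z) * z\<close>, whose meet is \<open>0\<close>;
  hence \<open>s = s * w + w \<le> w\<close>.  Finally, the complemented elements of a bounded distributive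
  lattice form a Boolean algebra, and only elements above \<open>0\<close> can be complemented.
\<close>

lemma clom_add_left_mono:
  fixes a b c :: "'a::comm_lattice_ordered_monoid"
  assumes "a \<le> b"
  shows "c + a \<le> c + b"
  using add_inf_distrib[of c a b] assms by (metis inf.absorb_iff1)

context al_monoid
begin

lemma ast_sup_le: "ast (sup a x) (sup a y) \<le> ast x y"
  using contraction_sup by (simp add: contraction_def)

lemma ast_inf_le: "ast (inf a x) (inf a y) \<le> ast x y"
  using contraction_inf by (simp add: contraction_def)

lemma ast_ast_le: "ast (ast a x) (ast a y) \<le> ast x y"
  using contraction_ast by (simp add: contraction_def)

lemma ast_self: "ast a a = 0"
  using inf_ast_sup[of a a] by simp

lemma ast_nonneg: "0 \<le> ast x y"
proof -
  have "ast (inf (inf x y) x) (inf (inf x y) y) \<le> ast x y"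
    by (rule ast_inf_le)
  moreover have "inf (inf x y) x = inf x y" "inf (inf x y) y = inf x y"
    by (simp_all add: inf.absorb1)
  ultimately show ?thesis by (simp add: ast_self)
qed

lemma ast_zero:
  assumes "0 \<le> a"
  shows "ast a 0 = a"
  using ast_inf_add[of a 0] assms by (simp add: inf.absorb2 sup.absorb1)

text \<open>Contraction by \<open>ast a\<close> on the pair \<open>x\<close>, \<open>a\<close> gives
  \<open>ast (ast a x) 0 \<le> ast x a\<close>, and the left side is \<open>ast a x\<close> because
  distances are nonnegative.\<close>

lemma ast_commute: "ast a x = ast x a"
proof -
  have "ast a x \<le> ast x a" for a x
    using ast_ast_le[of a x a] by (simp add: ast_self ast_zero ast_nonneg)
  then show ?thesis by (simp add: order.antisym)
qed

lemma ast_add_cancel: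
  assumes "b \<le> a"
  shows "ast a b + b = a"
  using ast_inf_add[of a b] assms by (simp add: inf.absorb2 sup.absorb1)

end

lemma al_monoid_inf_sup_distrib:
  fixes x y z :: "'a::al_monoid"
  shows "inf x (sup y z) = sup (inf x y) (inf x z)"
proof -
  let ?s = "inf x (sup y z)" and ?w = "sup (inf x y) (inf x z)"
  have w_le_s: "?w \<le> ?s"
    by (rule distrib_inf_le)
  \<comment> \<open>Joining with \<open>?w\<close> fixes \<open>?s\<close> and sends
    \<open>inf x t\<close> to \<open>?w\<close>; meeting with \<open>x\<close> sends
    \<open>sup y z\<close> to \<open>?s\<close> and \<open>t\<close> to
    \<open>inf x t\<close>.\<close>
  have bound: "ast ?s ?w \<le> ast t (sup y z)" if "inf x t \<le> ?w" for t
  proof -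
    have "ast (sup ?w ?s) (sup ?w (inf x t)) \<le> ast ?s (inf x t)"
      by (rule ast_sup_le)
    also have "\<dots> \<le> ast (sup y z) t"
      by (rule ast_inf_le)
    finally show ?thesis
      using w_le_s that by (simp only: sup.absorb1 sup.absorb2 ast_commute)
  qed
  have "ast ?s ?w \<le> inf (ast y (sup y z)) (ast z (sup y z))"
    by (intro inf.boundedI bound) simp_all
  then have "ast ?s ?w \<le> 0"
    by (simp add: inf_ast_sup)
  then have "ast ?s ?w = 0"
    using ast_nonneg by (rule order.antisym)
  then show ?thesis
    using ast_add_cancel[OF w_le_s] by simp
qed

lemma al_monoid_sup_inf_distrib:
  fixes x y z :: "'a::al_monoid"
  shows "sup x (inf y z) = inf (sup x y) (sup x z)"
  by (rule distrib_imp1) (rule al_monoid_inf_sup_distrib)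

lemma unity_nonneg:
  assumes "is_unity u"
  shows "0 \<le> u"
  using assms ast_nonneg[of 0 u] unfolding is_unity_def by (metis add_0)

lemma unity_greatest:
  assumes "is_unity u"
  shows "a \<le> u"
  \<comment> \<open>\<open>a = a + 0 \<le> a + ast a u = u\<close>.\<close>
  using assms clom_add_left_mono[OF ast_nonneg[of a u], of a] by (simp add: is_unity_def)

text \<open>De Morgan, from distributivity; exchanging elements with their complements also handles
  joins.\<close>

lemma complement_inf_sup:
  fixes a a' b b' u :: "'a::al_monoid"
  assumes "inf a a' = 0" "sup a a' = u" "inf b b' = 0" "sup b b' = u"
  shows "inf (inf a b) (sup a' b') = 0" and "sup (inf a b) (sup a' b') = u"
proof -
  \<comment> \<open>\<open>0\<close> need not be least in the whole algebra, so
    \<open>inf b 0 = 0\<close> rests on \<open>0\<close> being a meet with \<open>b\<close>.\<close>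
  have nonneg: "0 \<le> a" "0 \<le> b"
    using assms(1,3) by (metis inf.cobounded1)+
  have "inf (inf a b) (sup a' b') = sup (inf (inf a b) a') (inf (inf a b) b')"
    by (rule al_monoid_inf_sup_distrib)
  also have "\<dots> = sup (inf b (inf a a')) (inf a (inf b b'))"
    by (simp only: inf.assoc inf.left_commute)
  also have "\<dots> = 0"
    using nonneg by (simp add: assms(1,3) inf.absorb2)
  finally show "inf (inf a b) (sup a' b') = 0" .
  have le: "a' \<le> u" "b' \<le> u"
    using sup.cobounded2[of a' a] sup.cobounded2[of b' b] assms(2,4) by simp_all
  have "sup (inf a b) (sup a' b') = sup (sup a' b') (inf a b)"
    by (rule sup.commute)
  also have "\<dots> = inf (sup (sup a' b') a) (sup (sup a' b') b)"
    by (rule al_monoid_sup_inf_distrib)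
  also have "\<dots> = inf (sup b' (sup a a')) (sup a' (sup b b'))"
    by (simp only: sup.assoc sup.commute sup.left_commute)
  also have "\<dots> = u"
    using le by (simp add: assms(2,4) sup.absorb2)
  finally show "sup (inf a b) (sup a' b') = u" .
qed

lemma complemented_inf:
  assumes "complemented u a" "complemented u b"
  shows "complemented u (inf a b)"
proof -
  obtain a' b' where "inf a a' = 0" "sup a a' = u" "inf b b' = 0" "sup b b' = u"
    using assms unfolding complemented_def by blast
  from complement_inf_sup[OF this] show ?thesis
    unfolding complemented_def by blast
qed

lemma complemented_sup:
  assumes "complemented u a" "complemented u b"
  shows "complemented u (sup a b)"
proof -
  \<comment> \<open>The complements come first, so that \<open>inf a' b'\<close> emerges as the
    complement of \<open>sup a b\<close>.\<close>
  obtain a' b' where "inf a' a = 0" "sup a' a = u" "inf b' b = 0" "sup b' b = u"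
    using assms unfolding complemented_def by (auto simp: inf.commute sup.commute)
  note compl = complement_inf_sup[OF this]
  show ?thesis
    unfolding complemented_def
    using compl by (intro exI[of _ "inf a' b'"]) (simp add: inf.commute sup.commute)
qed

lemma complemented_nonneg:
  assumes "complemented u a"
  shows "0 \<le> a"
  using assms unfolding complemented_def by (metis inf.cobounded1)

theorem theorem3p8:
  fixes u :: "'a::al_monoid"
  assumes "is_unity u"
  shows "boolean_algebra_on {a. complemented u a} inf sup 0 u"
proof
  have bounds: "inf 0 u = 0" "sup 0 u = u"
    using unity_nonneg[OF assms] by (simp_all add: inf.absorb1 sup.absorb2)
  \<comment> \<open>\<open>0\<close> and \<open>u\<close> are complements of each other.\<close>
  show "0 \<in> {a. complemented u a}" "u \<in> {a. complemented u a}"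
    using bounds by (auto simp: complemented_def inf.commute sup.commute)
next
  fix x assume "x \<in> {a. complemented u a}"
  then show "\<exists>y\<in>{a. complemented u a}. inf x y = 0 \<and> sup x y = u"
    \<comment> \<open>A complement of \<open>x\<close> lies in the carrier, having \<open>x\<close>
      as its own complement.\<close>
    by (auto simp: complemented_def) (metis inf.commute sup.commute)
next
  fix x assume "x \<in> {a. complemented u a}"
  then show "sup x 0 = x" "inf x u = x"
    by (simp_all add: complemented_nonneg sup.absorb1 unity_greatest[OF assms] inf.absorb1)
next
  fix x y w :: 'a
  show "inf (inf x y) w = inf x (inf y w)" "sup (sup x y) w = sup x (sup y w)"
    by (rule inf.assoc sup.assoc)+
  show "inf x y = inf y x" "sup x y = sup y x"
    by (rule inf.commute sup.commute)+
  show "inf x (sup y w) = sup (inf x y) (inf x w)" "sup x (inf y w) = inf (sup x y) (sup x w)"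
    by (rule al_monoid_inf_sup_distrib al_monoid_sup_inf_distrib)+
qed (simp_all add: complemented_inf complemented_sup)

end
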